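(* The local truncation error $TE^n$ of the modified Crank–Nicolson scheme ($k=1$) $$ \frac{i}{\tau}(u^{n+1}-u^n)=-\frac12\Delta(u^{n+1}+u^n)+\frac{\lambda}{4}\bigl(|u^n|^2+|u^{n+1}|^2\bigr)(u^{n+1}+u^n) $$ is $O(\tau^2)$.
   Context: The scheme approximates the cubic nonlinear Schrödinger equation $iu_t=-\Delta u+\lambda|u|^2u$ in $\mathcal{D}\times(0,T)$, where $\mathcal{D}\subset\mathbf{R}^d$ ($d=1,2,3$) is a bounded domain, $T>0$, $\lambda=\pm1$, $i=\sqrt{-1}$ and $u$ is complex-valued. Here $\tau>0$ is the time step, $t_n=n\tau$ is a uniform mesh of $[0,T]$, and $k$ is the number of steps of the scheme. The local truncation error is defined by $$ TE^n=\frac{i}{\tau}\bigl(u(t_{n+1})-u(t_n)\bigr)+\frac12\Delta\bigl(u(t_{n+1})+u(t_n)\bigr)-\frac{\lambda}{4}\bigl(|u(t_n)|^2+|u(t_{n+1})|^2\bigr)\bigl(u(t_{n+1})+u(t_n)\bigr), $$ where $u(t)$ is the true solution of the equation, $iu_t(t)+\Delta u(t)-\lambda|u(t)|^2u(t)=0$, with the dependence on $x$ suppressed.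
   Formalization: The true solution u is assumed sufficiently smooth: time derivatives up to order three are continuous and bounded on [0,T]×D, u(t) is C² in space, and Δu is continuous up to t=0 and t=T; without such smoothness TE^n need not be O(τ²). *)

theory Defs
  imports "HOL-Analysis.Analysis"
begin

definition partial_deriv :: "'d::finite \<Rightarrow> (real ^ 'd \<Rightarrow> complex) \<Rightarrow> real ^ 'd \<Rightarrow> complex"
  where "partial_deriv i f x = vector_derivative (\<lambda>s. f (x + s *\<^sub>R axis i 1)) (at 0)"

definition laplacian :: "(real ^ 'd::finite \<Rightarrow> complex) \<Rightarrow> real ^ 'd \<Rightarrow> complex"
  where "laplacian f x = (\<Sum>i\<in>UNIV. partial_deriv i (partial_deriv i f) x)"

text \<open>The existence of the partial derivatives is required explicitly, since
  \<^const>\<open>vector_derivative\<close> is total. The set \<open>S\<close> is meant to be open.\<close>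

definition C1_on :: "(real ^ 'd::finite) set \<Rightarrow> (real ^ 'd \<Rightarrow> complex) \<Rightarrow> bool"
  where "C1_on S f \<longleftrightarrow> continuous_on S f \<and>
    (\<forall>i. (\<forall>x\<in>S. (\<lambda>s::real. f (x + s *\<^sub>R axis i 1)) differentiable (at 0)) \<and>
         continuous_on S (partial_deriv i f))"

definition C2_on :: "(real ^ 'd::finite) set \<Rightarrow> (real ^ 'd \<Rightarrow> complex) \<Rightarrow> bool"
  where "C2_on S f \<longleftrightarrow> C1_on S f \<and> (\<forall>i. C1_on S (partial_deriv i f))"

text \<open>\<open>u t x\<close> has \<open>m\<close> time derivatives on the closed interval \<open>[0,T]\<close> (one-sided at the
  end points); \<open>U k\<close> is the \<open>k\<close>-th one. All of them are continuous and bounded on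
  \<open>[0,T] \<times> D\<close>, which holds in particular if they extend continuously to
  \<open>[0,T] \<times> closure D\<close> with \<open>D\<close> bounded.\<close>

definition time_Cb :: "nat \<Rightarrow> real \<Rightarrow> (real ^ 'd::finite) set \<Rightarrow> (real \<Rightarrow> real ^ 'd \<Rightarrow> complex) \<Rightarrow> bool"
  where "time_Cb m T D u \<longleftrightarrow>
    (\<exists>U :: nat \<Rightarrow> real \<Rightarrow> real ^ 'd \<Rightarrow> complex. U 0 = u \<and>
      (\<forall>k<m. \<forall>t\<in>{0..T}. \<forall>x\<in>D.
         ((\<lambda>s. U k s x) has_vector_derivative U (Suc k) t x) (at t within {0..T})) \<and>
      (\<forall>k\<le>m. continuous_on ({0..T} \<times> D) (\<lambda>(t, x). U k t x) \<and>
               bounded ((\<lambda>(t, x). U k t x) ` ({0..T} \<times> D))))"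

definition NLS_solution :: "real \<Rightarrow> real \<Rightarrow> (real ^ 'd::finite) set \<Rightarrow> (real \<Rightarrow> real ^ 'd \<Rightarrow> complex) \<Rightarrow> bool"
  where "NLS_solution lam T D u \<longleftrightarrow>
    (\<forall>t\<in>{0<..<T}. \<forall>x\<in>D.
       \<i> * vector_derivative (\<lambda>s. u s x) (at t) =
         - laplacian (u t) x + of_real lam * (of_real (cmod (u t x)))\<^sup>2 * u t x)"

text \<open>Sufficient smoothness of the true solution for a second-order consistency estimate:
  three bounded time derivatives, and a Laplacian that is continuous up to the initial and
  final times (where the equation itself is not imposed).\<close>

definition smooth_enough :: "real \<Rightarrow> (real ^ 'd::finite) set \<Rightarrow> (real \<Rightarrow> real ^ 'd \<Rightarrow> complex) \<Rightarrow> bool"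
  where "smooth_enough T D u \<longleftrightarrow>
    time_Cb 3 T D u \<and> (\<forall>t\<in>{0..T}. C2_on D (u t)) \<and>
    continuous_on ({0..T} \<times> D) (\<lambda>(t, x). laplacian (u t) x)"

definition mCN_step :: "real \<Rightarrow> real \<Rightarrow> (real ^ 'd::finite) set \<Rightarrow> (real ^ 'd \<Rightarrow> complex) \<Rightarrow> (real ^ 'd \<Rightarrow> complex) \<Rightarrow> bool"
  where "mCN_step lam \<tau> D v w \<longleftrightarrow>
    (\<forall>x\<in>D. \<i> / of_real \<tau> * (w x - v x) =
       - (1/2) * laplacian (\<lambda>y. w y + v y) x
       + of_real lam / 4 * ((of_real (cmod (v x)))\<^sup>2 + (of_real (cmod (w x)))\<^sup>2) * (w x + v x))"

definition mCN_residual :: "real \<Rightarrow> real \<Rightarrow> (real ^ 'd::finite \<Rightarrow> complex) \<Rightarrow> (real ^ 'd \<Rightarrow> complex) \<Rightarrow> real ^ 'd \<Rightarrow> complex"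
  where "mCN_residual lam \<tau> v w x =
    \<i> / of_real \<tau> * (w x - v x)
    + 1/2 * laplacian (\<lambda>y. w y + v y) x
    - of_real lam / 4 * ((of_real (cmod (v x)))\<^sup>2 + (of_real (cmod (w x)))\<^sup>2) * (w x + v x)"

lemma mCN_step_iff_residual:
  "mCN_step lam \<tau> D v w \<longleftrightarrow> (\<forall>x\<in>D. mCN_residual lam \<tau> v w x = 0)"
  unfolding mCN_step_def mCN_residual_def
  by (intro ball_cong refl) (auto simp: algebra_simps eq_diff_eq)

definition truncation_error ::
  "real \<Rightarrow> real \<Rightarrow> (real \<Rightarrow> real ^ 'd::finite \<Rightarrow> complex) \<Rightarrow> nat \<Rightarrow> real ^ 'd \<Rightarrow> complex"
  where "truncation_error lam \<tau> u n =
    mCN_residual lam \<tau> (u (real n * \<tau>)) (u (real (Suc n) * \<tau>))"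

end

theory Submission
  imports Defs
begin

text \<open>
  At time level \<open>t\<close> the exact solution satisfies \<open>\<Delta>u = - i u_t + \<lambda> \<bar>u\<bar>\<^sup>2 u\<close>. Eliminating both
  Laplacians from the residual, with \<open>v = u(t_n)\<close> and \<open>w = u(t_{n+1})\<close>, leaves exactly
  \<open>i ((w - v) / \<tau> - (u_t(t_n) + u_t(t_{n+1})) / 2) + (\<lambda> / 4) (\<bar>w\<bar>\<^sup>2 - \<bar>v\<bar>\<^sup>2) (w - v)\<close>.
  The first term is the error of the trapezoidal rule for \<open>\<integral> u_t dt\<close>, divided by \<open>\<tau>\<close>: it is
  \<open>O(\<tau>\<^sup>2)\<close> because \<open>u_ttt\<close> is bounded (\<open>trapezoidal_rule_error\<close>). The second term is the
  defect between the average of \<open>\<bar>u\<bar>\<^sup>2 u\<close> at the two levels and the product of the averages of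
  \<open>\<bar>u\<bar>\<^sup>2\<close> and \<open>u\<close>; it is a product of two increments over one step, each \<open>O(\<tau>)\<close>
  (\<open>product_of_increments_bound\<close>).

  Two points need care. The Laplacian is only additive where the second partial derivatives
  exist, and it is taken of functions defined off \<open>D\<close> too, so \<open>laplacian_add\<close> uses that \<open>D\<close> is open.
  The equation is imposed for \<open>0 < t < T\<close> only, whereas the first and the last step use it at
  \<open>t = 0\<close> and \<open>t = T\<close>; there it follows by continuity (\<open>NLS_up_to_end_times\<close>).
\<close>

section \<open>The Laplacian of a sum\<close>

lemma partial_deriv_cong_open:
  assumes "open S" and "x \<in> S" and eq: "\<And>y. y \<in> S \<Longrightarrow> f y = g y"
  shows "partial_deriv i f x = partial_deriv i g x"
proof -
  have "((\<lambda>s::real. x + s *\<^sub>R axis i 1) \<longlongrightarrow> x + 0 *\<^sub>R axis i 1) (nhds 0)"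
    by (intro tendsto_intros filterlim_ident)
  then have "\<forall>\<^sub>F s::real in nhds 0. x + s *\<^sub>R axis i 1 \<in> S"
    using assms(1,2) by (auto dest: topological_tendstoD)
  then have "\<forall>\<^sub>F s::real in nhds 0.
      f (x + s *\<^sub>R axis i 1) = g (x + s *\<^sub>R axis i 1)"
    by eventually_elim (rule eq)
  then show ?thesis
    unfolding partial_deriv_def by (intro vector_derivative_cong_eq) auto
qed

lemma partial_deriv_add:
  assumes "C1_on S f" and "C1_on S g" and "x \<in> S"
  shows "partial_deriv i (\<lambda>y. f y + g y) x = partial_deriv i f x + partial_deriv i g x"
  using assms unfolding C1_on_def partial_deriv_def by simp

lemma laplacian_add:
  assumes "open S" and f: "C2_on S f" and g: "C2_on S g" and "x \<in> S"
  shows "laplacian (\<lambda>y. f y + g y) x = laplacian f x + laplacian g x"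
proof -
  have "partial_deriv i (partial_deriv i (\<lambda>y. f y + g y)) x =
      partial_deriv i (partial_deriv i f) x + partial_deriv i (partial_deriv i g) x" for i
  proof -
    have "partial_deriv i (partial_deriv i (\<lambda>y. f y + g y)) x =
        partial_deriv i (\<lambda>y. partial_deriv i f y + partial_deriv i g y) x"
      using f g by (intro partial_deriv_cong_open[OF assms(1,4)] partial_deriv_add)
        (auto simp: C2_on_def)
    also have "\<dots> = partial_deriv i (partial_deriv i f) x + partial_deriv i (partial_deriv i g) x"
      using f g \<open>x \<in> S\<close> by (intro partial_deriv_add[where S = S]) (auto simp: C2_on_def)
    finally show ?thesis .
  qed
  then show ?thesis
    by (simp add: laplacian_def sum.distrib)
qed

section \<open>The trapezoidal rule\<close>

lemma increment_bound:
  fixes g :: "real \<Rightarrow> 'a::real_normed_vector"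
  assumes deriv: "\<And>t. t \<in> {a..b} \<Longrightarrow> (g has_vector_derivative g' t) (at t within {a..b})"
    and bound: "\<And>t. t \<in> {a..b} \<Longrightarrow> norm (g' t) \<le> B"
    and t: "t \<in> {a..b}"
  shows "norm (g t - g a) \<le> B * (t - a)"
proof -
  have "norm (g t - g a) \<le> B * norm (t - a)"
  proof (rule differentiable_bound[where S = "{a..b}" and f' = "\<lambda>t h. h *\<^sub>R g' t"])
    show "(g has_derivative (\<lambda>h. h *\<^sub>R g' t)) (at t within {a..b})" if "t \<in> {a..b}" for t
      using deriv[OF that] by (simp add: has_vector_derivative_def)
    show "onorm (\<lambda>h. h *\<^sub>R g' t) \<le> B" if "t \<in> {a..b}" for t
      using bound[OF that] by (intro onorm_le) (simp add: mult.commute[of B] mult_left_mono)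
  qed (use t in auto)
  with t show ?thesis by simp
qed

text \<open>With \<open>F t\<close> the trapezoidal error over \<open>[a,t]\<close>, both \<open>F\<close> and \<open>F'\<close> vanish at \<open>a\<close> and
  \<open>F'' t = - ((t - a) / 2) g''' t\<close>, so the mean value inequality applied twice gives the
  bound. The sharp constant would be \<open>1/12\<close>.\<close>

lemma trapezoidal_rule_error:
  fixes g :: "real \<Rightarrow> 'a::real_normed_vector"
  assumes g: "\<And>t. t \<in> {a..b} \<Longrightarrow> (g has_vector_derivative g1 t) (at t within {a..b})"
    and g1: "\<And>t. t \<in> {a..b} \<Longrightarrow> (g1 has_vector_derivative g2 t) (at t within {a..b})"
    and g2: "\<And>t. t \<in> {a..b} \<Longrightarrow> (g2 has_vector_derivative g3 t) (at t within {a..b})"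
    and bound: "\<And>t. t \<in> {a..b} \<Longrightarrow> norm (g3 t) \<le> M"
    and "a \<le> b"
  shows "norm (g b - g a - ((b - a) / 2) *\<^sub>R (g1 a + g1 b)) \<le> M / 2 * (b - a) ^ 3"
proof -
  define h where "h = b - a"
  define F where "F t = g t - g a - ((t - a) / 2) *\<^sub>R (g1 a + g1 t)" for t
  define F1 where "F1 t = (1/2) *\<^sub>R (g1 t - g1 a) - ((t - a) / 2) *\<^sub>R g2 t" for t
  define F2 where "F2 t = - ((t - a) / 2) *\<^sub>R g3 t" for t
  have h: "0 \<le> h" using \<open>a \<le> b\<close> by (simp add: h_def)
  have "0 \<le> M"
    using bound[of a] \<open>a \<le> b\<close> order_trans[OF norm_ge_zero] by auto
  have F: "(F has_vector_derivative F1 t) (at t within {a..b})" if "t \<in> {a..b}" for t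
  proof -
    have "(F has_vector_derivative g1 t - 0 -
        (((t - a) / 2) *\<^sub>R (0 + g2 t) + (1/2) *\<^sub>R (g1 a + g1 t))) (at t within {a..b})"
      unfolding F_def
      by (intro has_vector_derivative_diff has_vector_derivative_scaleR
          has_vector_derivative_add has_vector_derivative_const g g1 that)
        (auto intro!: derivative_eq_intros)
    also have "g1 t - 0 - (((t - a) / 2) *\<^sub>R (0 + g2 t) + (1/2) *\<^sub>R (g1 a + g1 t)) =
        (g1 t - (1/2) *\<^sub>R g1 t) - (1/2) *\<^sub>R g1 a - ((t - a) / 2) *\<^sub>R g2 t"
      by (simp add: scaleR_right_distrib)
    also have "g1 t - (1/2) *\<^sub>R g1 t = (1/2) *\<^sub>R g1 t"
      using scaleR_left_diff_distrib[of 1 "1/2" "g1 t"] by simp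
    finally show ?thesis
      by (simp add: F1_def scaleR_right_diff_distrib)
  qed
  have F1: "(F1 has_vector_derivative F2 t) (at t within {a..b})" if "t \<in> {a..b}" for t
  proof -
    have "(F1 has_vector_derivative (1/2) *\<^sub>R (g2 t - 0) + 0 *\<^sub>R (g1 t - g1 a) -
        (((t - a) / 2) *\<^sub>R g3 t + (1/2) *\<^sub>R g2 t)) (at t within {a..b})"
      unfolding F1_def
      by (intro has_vector_derivative_diff has_vector_derivative_scaleR
          has_vector_derivative_const g1 g2 that)
        (auto intro!: derivative_eq_intros)
    then show ?thesis
      by (simp add: F2_def algebra_simps)
  qed
  have F2_le: "norm (F2 t) \<le> h / 2 * M" if "t \<in> {a..b}" for t
    using that bound[OF that] h unfolding F2_def h_def
    by (auto intro!: mult_mono)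
  have F1_le: "norm (F1 t) \<le> h / 2 * M * h" if "t \<in> {a..b}" for t
  proof -
    have "norm (F1 t - F1 a) \<le> h / 2 * M * (t - a)"
      using F1 F2_le that by (rule increment_bound)
    also have "\<dots> \<le> h / 2 * M * h"
      using that h \<open>0 \<le> M\<close> by (intro mult_left_mono) (auto simp: h_def)
    finally show ?thesis by (simp add: F1_def)
  qed
  have "norm (F b - F a) \<le> h / 2 * M * h * (b - a)"
    using F F1_le by (rule increment_bound) (use \<open>a \<le> b\<close> in auto)
  then show ?thesis
    by (simp add: F_def h_def power3_eq_cube algebra_simps)
qed

section \<open>The truncation error\<close>

lemma product_of_increments_bound:
  fixes v w :: complex
  assumes "cmod v \<le> M" and "cmod w \<le> M" and "cmod (w - v) \<le> d"
  shows "cmod (((of_real (cmod w))\<^sup>2 - (of_real (cmod v))\<^sup>2) * (w - v)) \<le> 2 * M * d\<^sup>2"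
proof -
  have "0 \<le> d" "0 \<le> M"
    using assms norm_ge_zero order_trans by blast+
  have "cmod (((of_real (cmod w))\<^sup>2 - (of_real (cmod v))\<^sup>2) * (w - v)) =
      \<bar>cmod w - cmod v\<bar> * (cmod w + cmod v) * cmod (w - v)"
  proof -
    have "(complex_of_real (cmod w))\<^sup>2 - (of_real (cmod v))\<^sup>2 =
        of_real ((cmod w - cmod v) * (cmod w + cmod v))"
      by (simp add: power2_eq_square algebra_simps)
    then show ?thesis
      by (simp only: norm_mult norm_of_real abs_mult) simp
  qed
  also have "\<dots> \<le> d * (2 * M) * d"
    using assms \<open>0 \<le> d\<close> \<open>0 \<le> M\<close> norm_triangle_ineq3[of w v]
    by (intro mult_mono) auto
  finally show ?thesis
    by (simp add: power2_eq_square algebra_simps)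
qed

lemma NLS_up_to_end_times:
  fixes u :: "real \<Rightarrow> real ^ 'd::finite \<Rightarrow> complex"
  assumes "NLS_solution lam T D u" and "T > 0" and "x \<in> D"
    and deriv: "\<And>t. t \<in> {0..T} \<Longrightarrow> ((\<lambda>s. u s x) has_vector_derivative u' t) (at t within {0..T})"
    and cont_u': "continuous_on {0..T} u'"
    and cont_lap: "continuous_on {0..T} (\<lambda>t. laplacian (u t) x)"
    and t: "t \<in> {0..T}"
  shows "laplacian (u t) x = - \<i> * u' t + of_real lam * (of_real (cmod (u t x)))\<^sup>2 * u t x"
proof -
  define R where "R t = laplacian (u t) x + \<i> * u' t
      - of_real lam * (of_real (cmod (u t x)))\<^sup>2 * u t x" for t
  have cont_u: "continuous_on {0..T} (\<lambda>t. u t x)"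
    by (rule continuous_on_vector_derivative[OF deriv])
  have "continuous_on {0..T} R"
    unfolding R_def by (intro continuous_intros cont_u cont_u' cont_lap)
  moreover have "R t = 0" if "t \<in> {0<..<T}" for t
  proof -
    have "vector_derivative (\<lambda>s. u s x) (at t) = u' t"
      using deriv[of t] that by (intro vector_derivative_at) (simp add: at_within_Icc_at)
    moreover have "\<i> * vector_derivative (\<lambda>s. u s x) (at t) =
        - laplacian (u t) x + of_real lam * (of_real (cmod (u t x)))\<^sup>2 * u t x"
      using assms(1) that \<open>x \<in> D\<close> unfolding NLS_solution_def by blast
    ultimately show ?thesis
      by (simp add: R_def)
  qed
  ultimately have "R t = 0"
    using continuous_constant_on_closure[of "{0<..<T}" R 0 t] t \<open>T > 0\<close> by simp
  then show ?thesis
    by (simp add: R_def algebra_simps)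
qed

text \<open>What remains of the residual once the equation has replaced the Laplacian at both
  levels: the trapezoidal error of \<open>u_t\<close> and the defect
  \<open>(\<bar>v\<bar>\<^sup>2 v + \<bar>w\<bar>\<^sup>2 w) / 2 - (\<bar>v\<bar>\<^sup>2 + \<bar>w\<bar>\<^sup>2) (v + w) / 4\<close> of the cubic term, which factors.\<close>

lemma mCN_residual_eq:
  fixes v w :: "real ^ 'd::finite \<Rightarrow> complex"
  assumes "laplacian (\<lambda>y. w y + v y) x = laplacian w x + laplacian v x"
    and "laplacian v x = - \<i> * v' + of_real lam * (of_real (cmod (v x)))\<^sup>2 * v x"
    and "laplacian w x = - \<i> * w' + of_real lam * (of_real (cmod (w x)))\<^sup>2 * w x"
    and "\<tau> \<noteq> 0"
  shows "mCN_residual lam \<tau> v w x =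
      \<i> / of_real \<tau> * (w x - v x - (\<tau> / 2) *\<^sub>R (v' + w')) +
      of_real lam / 4 *
        (((of_real (cmod (w x)))\<^sup>2 - (of_real (cmod (v x)))\<^sup>2) * (w x - v x))"
  unfolding mCN_residual_def assms(1-3) scaleR_conv_of_real
  using \<open>\<tau> \<noteq> 0\<close> by (simp add: field_simps)

theorem lemma3p1:
  fixes D :: "(real ^ 'd::finite) set"
    and u :: "real \<Rightarrow> real ^ 'd \<Rightarrow> complex"
    and T lam :: real
  assumes "CARD('d) \<in> {1, 2, 3}"
    and "open D" and "connected D" and "bounded D" and "D \<noteq> {}"
    and "T > 0"
    and "lam \<in> {-1, 1}"
    and "smooth_enough T D u"
    and "NLS_solution lam T D u"
  shows "\<exists>C. \<forall>\<tau>>0. \<forall>n. real (Suc n) * \<tau> \<le> T \<longrightarrow>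
           (\<forall>x\<in>D. cmod (truncation_error lam \<tau> u n x) \<le> C * \<tau>\<^sup>2)"
proof -
  have C2: "C2_on D (u t)" if "t \<in> {0..T}" for t
    using assms(8) that by (simp add: smooth_enough_def)
  have cont_lap: "continuous_on ({0..T} \<times> D) (\<lambda>(t, x). laplacian (u t) x)"
    using assms(8) by (simp add: smooth_enough_def)
  from assms(8) obtain U where U0: "U 0 = u"
    and deriv: "\<And>k t x. k < 3 \<Longrightarrow> t \<in> {0..T} \<Longrightarrow> x \<in> D \<Longrightarrow>
      ((\<lambda>s. U k s x) has_vector_derivative U (Suc k) t x) (at t within {0..T})"
    and cont: "\<And>k. k \<le> 3 \<Longrightarrow> continuous_on ({0..T} \<times> D) (\<lambda>(t, x). U k t x)"
    and bdd: "\<And>k. k \<le> 3 \<Longrightarrow> bounded ((\<lambda>(t, x). U k t x) ` ({0..T} \<times> D))"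
    unfolding smooth_enough_def time_Cb_def by blast
  have "\<exists>M. \<forall>t\<in>{0..T}. \<forall>x\<in>D. cmod (U k t x) \<le> M" if "k \<le> 3" for k
    using bdd[OF that] by (auto simp: bounded_iff)
  then obtain M where M: "\<And>k t x. k \<le> 3 \<Longrightarrow> t \<in> {0..T} \<Longrightarrow> x \<in> D \<Longrightarrow> cmod (U k t x) \<le> M k"
    by metis
  have slice: "continuous_on {0..T} (\<lambda>t. f t x)"
    if "continuous_on ({0..T} \<times> D) (\<lambda>(t, x). f t x)" "x \<in> D"
    for f :: "real \<Rightarrow> real ^ 'd \<Rightarrow> complex" and x
    using continuous_on_compose2[OF that(1), of "{0..T}" "\<lambda>t. (t, x)"] that(2)
    by (force intro!: continuous_intros)
  have NLS: "laplacian (u t) x = - \<i> * U 1 t x + of_real lam * (of_real (cmod (u t x)))\<^sup>2 * u t x"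
    if "t \<in> {0..T}" "x \<in> D" for t x
    using deriv[of 0] that slice[OF cont[of 1]] slice[OF cont_lap]
    by (intro NLS_up_to_end_times[OF assms(9,6), of _ "\<lambda>t. U 1 t x"]) (auto simp: U0)

  have "cmod (truncation_error lam \<tau> u n x) \<le> (M 3 / 2 + M 0 * (M 1)\<^sup>2 / 2) * \<tau>\<^sup>2"
    if "\<tau> > 0" and le: "real (Suc n) * \<tau> \<le> T" and "x \<in> D" for \<tau> n x
  proof -
    define a b where "a = real n * \<tau>" and "b = real (Suc n) * \<tau>"
    have ba: "b - a = \<tau>" by (simp add: a_def b_def algebra_simps)
    have "0 \<le> a" "a \<le> b" "b \<le> T"
      using \<open>\<tau> > 0\<close> le ba by (auto simp: a_def b_def)
    then have sub: "{a..b} \<subseteq> {0..T}" and a: "a \<in> {0..T}" and b: "b \<in> {0..T}" by auto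
    have deriv_ab: "((\<lambda>s. U k s x) has_vector_derivative U (Suc k) t x) (at t within {a..b})"
      if "k < 3" "t \<in> {a..b}" for k t
      using deriv[OF \<open>k < 3\<close> _ \<open>x \<in> D\<close>] that(2) sub
      by (meson has_vector_derivative_within_subset subsetD)
    have trap: "cmod (u b x - u a x - (\<tau> / 2) *\<^sub>R (U 1 a x + U 1 b x)) \<le> M 3 / 2 * \<tau> ^ 3"
      using trapezoidal_rule_error[of a b "\<lambda>t. U 0 t x" "\<lambda>t. U 1 t x" "\<lambda>t. U 2 t x"
          "\<lambda>t. U 3 t x" "M 3"]
        deriv_ab[of 0] deriv_ab[of 1] deriv_ab[of 2] M[of 3 _ x] sub \<open>a \<le> b\<close> \<open>x \<in> D\<close>
      by (auto simp: U0 ba numeral_2_eq_2 numeral_3_eq_3)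
    have "cmod (U 0 b x - U 0 a x) \<le> M 1 * (b - a)"
      using deriv_ab[of 0] M[of 1 _ x] sub \<open>a \<le> b\<close> \<open>x \<in> D\<close>
      by (intro increment_bound[where b = b and g' = "\<lambda>t. U 1 t x"]) auto
    then have incr: "cmod (((of_real (cmod (u b x)))\<^sup>2 - (of_real (cmod (u a x)))\<^sup>2) *
        (u b x - u a x)) \<le> 2 * M 0 * (M 1 * \<tau>)\<^sup>2"
      using M[of 0] a b \<open>x \<in> D\<close>
      by (intro product_of_increments_bound) (auto simp: U0 ba)
    have "cmod (truncation_error lam \<tau> u n x) =
        cmod (\<i> / of_real \<tau> * (u b x - u a x - (\<tau> / 2) *\<^sub>R (U 1 a x + U 1 b x)) +
          of_real lam / 4 *
            (((of_real (cmod (u b x)))\<^sup>2 - (of_real (cmod (u a x)))\<^sup>2) * (u b x - u a x)))"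
      unfolding truncation_error_def a_def[symmetric] b_def[symmetric]
      using \<open>\<tau> > 0\<close> \<open>x \<in> D\<close> a b
      by (subst mCN_residual_eq[OF laplacian_add[OF \<open>open D\<close>] NLS NLS]) (auto intro: C2)
    also have "\<dots> \<le> 1 / \<tau> * (M 3 / 2 * \<tau> ^ 3) + 1 / 4 * (2 * M 0 * (M 1 * \<tau>)\<^sup>2)"
    proof (rule norm_triangle_mono)
      show "cmod (\<i> / of_real \<tau> * (u b x - u a x - (\<tau> / 2) *\<^sub>R (U 1 a x + U 1 b x)))
          \<le> 1 / \<tau> * (M 3 / 2 * \<tau> ^ 3)"
        unfolding norm_mult norm_divide
        using trap \<open>\<tau> > 0\<close> by (intro mult_mono) auto
      have "\<bar>lam\<bar> = 1" using assms(7) by auto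
      then show "cmod (of_real lam / 4 *
          (((of_real (cmod (u b x)))\<^sup>2 - (of_real (cmod (u a x)))\<^sup>2) * (u b x - u a x)))
          \<le> 1 / 4 * (2 * M 0 * (M 1 * \<tau>)\<^sup>2)"
        unfolding norm_mult[of "of_real lam / 4"] norm_divide
        using incr by (intro mult_mono) auto
    qed
    also have "\<dots> = (M 3 / 2 + M 0 * (M 1)\<^sup>2 / 2) * \<tau>\<^sup>2"
      using \<open>\<tau> > 0\<close> by (simp add: field_simps power2_eq_square power3_eq_cube)
    finally show ?thesis .
  qed
  then show ?thesis by blast
qed

end
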